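(* Let $n\ge 1$, let $f\colon[0,\infty)\to(0,\infty)$ be a function and let $M(x,y)=f(x)f(y)$ for $x,y\ge 0$. Then $$\rho_M(x,y)=\frac{|x-y|}{f(|x|)f(|y|)}$$ is a metric in $\mathbb{R}^n$ if and only if all of the following hold: (i) $f$ is increasing; (ii) $f(x)/x$ is decreasing for $x>0$; (iii) $f$ is convex.
   Context: $|\cdot|$ is the Euclidean norm. "Increasing" and "decreasing" are meant in the non-strict sense. Convexity is on $[0,\infty)$. *)

theory Defs
  imports "HOL-Analysis.Analysis"
begin

definition rho :: "(real \<Rightarrow> real \<Rightarrow> real) \<Rightarrow> (real ^ 'n) \<Rightarrow> (real ^ 'n) \<Rightarrow> real" where
  "rho M x y = norm (x - y) / M (norm x) (norm y)"

end

theory Submission imports Defs begin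

text \<open>
  Cleared of denominators, the triangle inequality reads
  \<open>|x - y| f(|z|) \<le> |x - z| f(|y|) + |z - y| f(|x|)\<close>.
  It holds for \<open>f = 1\<close> (ordinary triangle inequality) and for \<open>f(t) = t\<close> (Ptolemy's
  inequality), hence for every affine function with nonnegative coefficients. Under (i)--(iii),
  for any three radii \<open>a\<close>, \<open>b\<close>, \<open>c\<close> such an affine function can be chosen that lies above
  \<open>f\<close> at \<open>c\<close> and below \<open>f\<close> at \<open>a\<close> and \<open>b\<close>. Conversely, all three conditions
  are read off from collinear triples through the origin.
\<close>

text \<open>Under the inversion \<open>x / |x|^2\<close>, distances become
  \<open>|x - y| / (|x| |y|)\<close>; multiplying by \<open>|x|^2 |y|^2\<close> gives a form that
  also makes sense at the origin.\<close>

lemma norm_inversion_diff: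
  fixes x y :: "'a::real_inner"
  shows "norm ((norm y)\<^sup>2 *\<^sub>R x - (norm x)\<^sup>2 *\<^sub>R y) = norm x * norm y * norm (x - y)"
proof (rule power2_eq_imp_eq)
  show "(norm ((norm y)\<^sup>2 *\<^sub>R x - (norm x)\<^sup>2 *\<^sub>R y))\<^sup>2 = (norm x * norm y * norm (x - y))\<^sup>2"
    by (simp add: power_mult_distrib power2_norm_eq_inner inner_diff inner_commute algebra_simps)
qed auto

text \<open>Away from the origin this is the ordinary triangle inequality for the inverted points,
  with denominators cleared.\<close>

lemma ptolemy_inequality:
  fixes x y z :: "'a::real_inner"
  shows "norm (x - y) * norm z \<le> norm (x - z) * norm y + norm (z - y) * norm x"
proof (cases "x = 0 \<or> y = 0 \<or> z = 0")
  case True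
  then show ?thesis
    using norm_triangle_ineq4[of x y] by (auto simp: norm_minus_commute mult.commute)
next
  case False
  define a b c where "a = norm x" "b = norm y" "c = norm z"
  have pos: "a > 0" "b > 0" "c > 0"
    using False by (auto simp: a_b_c_def)
  \<comment> \<open>The inverses of \<open>x\<close> and \<open>y\<close> differ by a telescoping
    sum through the inverse of \<open>z\<close>, here scaled by
    \<open>a\<^sup>2 * b\<^sup>2 * c\<^sup>2\<close>.\<close>
  have "c\<^sup>2 *\<^sub>R (b\<^sup>2 *\<^sub>R x - a\<^sup>2 *\<^sub>R y) = b\<^sup>2 *\<^sub>R (c\<^sup>2 *\<^sub>R x - a\<^sup>2 *\<^sub>R z) + a\<^sup>2 *\<^sub>R (b\<^sup>2 *\<^sub>R z - c\<^sup>2 *\<^sub>R y)"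
    by (simp add: algebra_simps)
  then have "norm (c\<^sup>2 *\<^sub>R (b\<^sup>2 *\<^sub>R x - a\<^sup>2 *\<^sub>R y))
      \<le> norm (b\<^sup>2 *\<^sub>R (c\<^sup>2 *\<^sub>R x - a\<^sup>2 *\<^sub>R z)) + norm (a\<^sup>2 *\<^sub>R (b\<^sup>2 *\<^sub>R z - c\<^sup>2 *\<^sub>R y))"
    by (metis norm_triangle_ineq)
  then have "c\<^sup>2 * (a * b * norm (x - y)) \<le> b\<^sup>2 * (a * c * norm (x - z)) + a\<^sup>2 * (c * b * norm (z - y))"
    by (simp only: norm_scaleR norm_inversion_diff a_b_c_def abs_power2 abs_norm_cancel power2_abs)
  then have "(a * b * c) * (norm (x - y) * c) \<le> (a * b * c) * (norm (x - z) * b + norm (z - y) * a)"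
    by (simp add: algebra_simps power2_eq_square)
  then have "norm (x - y) * c \<le> norm (x - z) * b + norm (z - y) * a"
    using pos by (subst (asm) mult_le_cancel_left_pos) auto
  then show ?thesis
    by (simp add: a_b_c_def)
qed

text \<open>The choice depends on where \<open>c\<close> lies: a constant to the left of
  \<open>a\<close>, the chord of \<open>f\<close> over the interval strictly between
  \<open>a\<close> and \<open>b\<close>, and otherwise the line joining the origin to the graph
  point at \<open>c\<close>.\<close>

lemma separating_affine_function:
  fixes f :: "real \<Rightarrow> real"
  assumes pos: "\<And>t. t \<ge> 0 \<Longrightarrow> f t > 0"
    and mono: "mono_on {0..} f" and anti: "antimono_on {0<..} (\<lambda>t. f t / t)"
    and conv: "convex_on {0..} f"
    and ab: "0 \<le> a" "a \<le> b" and c: "0 \<le> c"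
  obtains \<alpha> \<beta> where "0 \<le> \<alpha>" "0 \<le> \<beta>" "f c \<le> \<alpha> + \<beta> * c" "\<alpha> + \<beta> * a \<le> f a" "\<alpha> + \<beta> * b \<le> f b"
proof -
  \<comment> \<open>Condition (ii) without division, extended to \<open>s = 0\<close>.\<close>
  have star: "f t * s \<le> f s * t" if "0 \<le> s" "s \<le> t" for s t
  proof (cases "s = 0")
    case True
    then show ?thesis using pos[of s] that by simp
  next
    case False
    then have "f t / t \<le> f s / s"
      using anti that by (auto simp: monotone_on_def)
    then show ?thesis using False that by (simp add: field_simps)
  qed
  consider "c \<le> a" | "a < c" "c < b" | "a < c" "b \<le> c"
    by linarith
  then show thesis
  proof cases
    case 1
    then have "f c \<le> f a" "f c \<le> f b"
      using mono ab c by (auto simp: monotone_on_def)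
    then show thesis using that[of "f c" 0] pos[OF c] by simp
  next
    case 2
    define \<beta> where "\<beta> = (f b - f a) / (b - a)"
    have "f c \<le> \<beta> * (c - a) + f a"
      unfolding \<beta>_def
      by (rule convex_onD_Icc') (use 2 ab conv in \<open>auto intro: convex_on_subset\<close>)
    moreover have "0 \<le> \<beta>"
      using mono 2 ab unfolding \<beta>_def by (auto simp: monotone_on_def)
    moreover have "\<beta> * (b - a) = f b - f a"
      using 2 unfolding \<beta>_def by simp
    \<comment> \<open>The intercept of the chord is \<open>(b * f a - a * f b) / (b - a)\<close>, so
      its sign comes from \<open>star\<close>.\<close>
    moreover have "0 \<le> f a - \<beta> * a"
      using star[of a b] 2 ab unfolding \<beta>_def by (simp add: field_simps)
    ultimately show thesis
      using that[of "f a - \<beta> * a" \<beta>] by (simp add: algebra_simps)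
  next
    case 3
    then have "f c / c * a \<le> f a" "f c / c * b \<le> f b" "0 \<le> f c / c"
      using star[of a c] star[of b c] pos[OF c] ab by (auto simp: field_simps)
    then show thesis using that[of 0 "f c / c"] 3 ab by simp
  qed
qed

lemma weighted_ptolemy_inequality:
  fixes f :: "real \<Rightarrow> real" and x y z :: "'a::real_inner"
  assumes pos: "\<And>t. t \<ge> 0 \<Longrightarrow> f t > 0"
    and "mono_on {0..} f" "antimono_on {0<..} (\<lambda>t. f t / t)" "convex_on {0..} f"
  shows "norm (x - y) * f (norm z) \<le> norm (x - z) * f (norm y) + norm (z - y) * f (norm x)"
proof -
  \<comment> \<open>The affine function is available for ordered radii only; the inequality is
    symmetric in \<open>x\<close> and \<open>y\<close>, so one order suffices.\<close>
  have *: "norm (x - y) * f (norm z) \<le> norm (x - z) * f (norm y) + norm (z - y) * f (norm x)"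
    if le: "norm x \<le> norm y" for x y :: 'a
  proof -
    obtain \<alpha> \<beta> where ab: "0 \<le> \<alpha>" "0 \<le> \<beta>" "f (norm z) \<le> \<alpha> + \<beta> * norm z"
      "\<alpha> + \<beta> * norm x \<le> f (norm x)" "\<alpha> + \<beta> * norm y \<le> f (norm y)"
      using separating_affine_function[OF assms norm_ge_zero le norm_ge_zero] by blast
    have "norm (x - y) * f (norm z) \<le> norm (x - y) * (\<alpha> + \<beta> * norm z)"
      by (intro mult_left_mono ab) auto
    also have "\<dots> = \<alpha> * norm (x - y) + \<beta> * (norm (x - y) * norm z)"
      by (simp add: algebra_simps)
    also have "\<dots> \<le> \<alpha> * (norm (x - z) + norm (z - y))
        + \<beta> * (norm (x - z) * norm y + norm (z - y) * norm x)"
      using norm_triangle_ineq[of "x - z" "z - y"]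
      by (intro add_mono mult_left_mono ab ptolemy_inequality) auto
    also have "\<dots> = norm (x - z) * (\<alpha> + \<beta> * norm y) + norm (z - y) * (\<alpha> + \<beta> * norm x)"
      by (simp add: algebra_simps)
    also have "\<dots> \<le> norm (x - z) * f (norm y) + norm (z - y) * f (norm x)"
      by (intro add_mono mult_left_mono ab) auto
    finally show ?thesis .
  qed
  show ?thesis
    using *[of x y] *[of y x] by (cases "norm x \<le> norm y") (auto simp: norm_minus_commute)
qed

text \<open>The hypothesis is the cleared triangle inequality for the multiples \<open>r\<close>,
  \<open>s\<close>, \<open>t\<close> of one unit vector.\<close>

lemma line_inequality_imp_conditions:
  fixes f :: "real \<Rightarrow> real"
  assumes line: "\<And>r s t. \<bar>r - s\<bar> * f \<bar>t\<bar> \<le> \<bar>r - t\<bar> * f \<bar>s\<bar> + \<bar>t - s\<bar> * f \<bar>r\<bar>"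
  shows "mono_on {0..} f" "antimono_on {0<..} (\<lambda>t. f t / t)" "convex_on {0..} f"
proof -
  show "mono_on {0..} f"
  proof (rule monotone_onI)
    fix s t :: real
    assume st: "s \<in> {0..}" "t \<in> {0..}" "s \<le> t"
    \<comment> \<open>The point \<open>s\<close> lies between \<open>t\<close> and
      \<open>-t\<close>, so its distances to them add up to \<open>2 * t\<close>.\<close>
    have "(2 * t) * f s \<le> (2 * t) * f t"
      using line[of t "-t" s] st by (simp add: algebra_simps)
    then show "f s \<le> f t"
      using st by (cases "t = 0") auto
  qed
  show "antimono_on {0<..} (\<lambda>t. f t / t)"
  proof (rule monotone_onI)
    fix s t :: real
    assume st: "s \<in> {0<..}" "t \<in> {0<..}" "s \<le> t"
    \<comment> \<open>Now \<open>t\<close> lies beyond the pair \<open>s\<close>, \<open>-s\<close>: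
      the distances \<open>t - s\<close> and \<open>t + s\<close> again sum to \<open>2 * t\<close>,
      while the pair is only \<open>2 * s\<close> apart.\<close>
    have "s * f t \<le> t * f s"
      using line[of s "-s" t] st by (simp add: algebra_simps)
    then show "f t / t \<le> f s / s"
      using st by (simp add: field_simps)
  qed
  show "convex_on {0..} f"
  proof (rule convex_onI)
    fix t x y :: real
    assume t: "0 < t" "t < 1" and xy: "x \<in> {0..}" "y \<in> {0..}"
    define z where "z = (1 - t) * x + t * y"
    have "0 \<le> z"
      using t xy by (simp add: z_def)
    have "x - z = t * (x - y)" "z - y = (1 - t) * (x - y)"
      by (simp_all add: z_def algebra_simps)
    then have dists: "\<bar>x - z\<bar> = t * \<bar>x - y\<bar>" "\<bar>z - y\<bar> = (1 - t) * \<bar>x - y\<bar>"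
      using t by (simp_all add: abs_mult)
    \<comment> \<open>Each endpoint value is weighted by the distance from \<open>z\<close> to the
      opposite endpoint, which yields exactly the convex weights.\<close>
    have "\<bar>x - y\<bar> * f z \<le> \<bar>x - y\<bar> * ((1 - t) * f x + t * f y)"
      using line[of x y z] xy \<open>0 \<le> z\<close> unfolding dists by (simp add: algebra_simps)
    then show "f ((1 - t) *\<^sub>R x + t *\<^sub>R y) \<le> (1 - t) * f x + t * f y"
    proof (cases "x = y")
      case True
      then show ?thesis by (simp add: algebra_simps)
    next
      case False
      with \<open>\<bar>x - y\<bar> * f z \<le> _\<close> have "f z \<le> (1 - t) * f x + t * f y"
        by (subst (asm) mult_le_cancel_left_pos) auto
      then show ?thesis by (simp add: z_def)
    qed
  qed auto
qed

theorem theorem1p2: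
  fixes f :: "real \<Rightarrow> real" and M :: "real \<Rightarrow> real \<Rightarrow> real"
  assumes f_pos: "\<And>t. t \<ge> 0 \<Longrightarrow> f t > 0"
    and M_eq: "\<And>s t. s \<ge> 0 \<Longrightarrow> t \<ge> 0 \<Longrightarrow> M s t = f s * f t"
  shows "Metric_space (UNIV :: (real ^ 'n) set) (rho M) \<longleftrightarrow>
    mono_on {0..} f \<and> antimono_on {0<..} (\<lambda>t. f t / t) \<and> convex_on {0..} f"
proof -
  have fn: "f (norm x) > 0" for x :: "real ^ 'n"
    by (simp add: f_pos)
  have rho: "rho M x y = norm (x - y) / (f (norm x) * f (norm y))" for x y :: "real ^ 'n"
    by (simp add: rho_def M_eq)
  \<comment> \<open>Both sides are brought to the common positive denominator
    \<open>f (norm x) * f (norm y) * f (norm z)\<close>.\<close>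
  have triangle_iff: "rho M x y \<le> rho M x z + rho M z y \<longleftrightarrow>
      norm (x - y) * f (norm z) \<le> norm (x - z) * f (norm y) + norm (z - y) * f (norm x)"
    for x y z :: "real ^ 'n"
  proof -
    have "rho M x y = norm (x - y) * f (norm z) / (f (norm x) * f (norm y) * f (norm z))"
      "rho M x z + rho M z y = (norm (x - z) * f (norm y) + norm (z - y) * f (norm x))
        / (f (norm x) * f (norm y) * f (norm z))"
      using fn[of x] fn[of y] fn[of z] by (simp_all add: rho field_simps)
    moreover have "f (norm x) * f (norm y) * f (norm z) > 0"
      using fn by simp
    ultimately show ?thesis
      by (simp only: divide_le_cancel) simp
  qed
  show ?thesis
  proof (intro iffI)
    assume metric: "Metric_space (UNIV :: (real ^ 'n) set) (rho M)"
    \<comment> \<open>A unit vector exists since the dimension is at least 1; its span carries all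
      the collinear triples.\<close>
    obtain e :: "real ^ 'n" where e: "norm e = 1"
      using vector_choose_size[of 1] by auto
    have "\<bar>r - s\<bar> * f \<bar>t\<bar> \<le> \<bar>r - t\<bar> * f \<bar>s\<bar> + \<bar>t - s\<bar> * f \<bar>r\<bar>" for r s t
      using Metric_space.triangle[OF metric, of "r *\<^sub>R e" "t *\<^sub>R e" "s *\<^sub>R e"]
      unfolding triangle_iff by (simp flip: scaleR_diff_left add: e)
    then show "mono_on {0..} f \<and> antimono_on {0<..} (\<lambda>t. f t / t) \<and> convex_on {0..} f"
      using line_inequality_imp_conditions by blast
  next
    assume conditions: "mono_on {0..} f \<and> antimono_on {0<..} (\<lambda>t. f t / t) \<and> convex_on {0..} f"
    show "Metric_space (UNIV :: (real ^ 'n) set) (rho M)"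
    proof
      fix x y z :: "real ^ 'n"
      show "0 \<le> rho M x y"
        using fn[of x] fn[of y] by (simp add: rho)
      show "rho M x y = rho M y x"
        by (simp add: rho norm_minus_commute mult.commute)
      show "rho M x y = 0 \<longleftrightarrow> x = y"
        using fn[of x] fn[of y] by (simp add: rho)
      show "rho M x z \<le> rho M x y + rho M y z"
        unfolding triangle_iff
        using weighted_ptolemy_inequality[of f] f_pos conditions by blast
    qed
  qed
qed

end
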